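(* Let $V$ and $F$ be Fréchet spaces and let $U\subset V$ be open. A map $f:U\to F$ is $C^1_F$-smooth if and only if it is $C^1_{MB}$-smooth and the map $U\ni u\mapsto Df(u)\in L_c(V,F)$ is $\beta$-continuous.
   Context: For topological vector spaces $V,W$, $L_c(V,W)$ denotes the vector space of continuous linear maps $V\to W$; the topology $\beta$ on $L_c(V,W)$ is that of uniform convergence on bounded sets (basic neighbourhoods of $0$: $\{A\in L_c(V,W): AB\subset N\}$ with $B\subset V$ bounded and $N$ a neighbourhood of $0$ in $W$). A map into $L_c(V,W)$ is $\beta$-continuous if it is continuous with respect to $\beta$. Directional derivatives are $Df(u)v=\lim_{0\ne t\to0}\frac1t(f(u+tv)-f(u))$. A continuous map $f:V\supset U\to W$, $U$ open, is $C^1_{MB}$-smooth (Michal–Bastiani) if all directional derivatives $Df(u)v$, $u\in U$, $v\in V$, exist and the map $U\times V\ni(u,v)\mapsto Df(u)v\in W$ is continuous. (For Fréchet spaces each $Df(u)$ is then linear and continuous.) A continuous map $f:V\supset U\to W$, $U$ open, is $C^1_F$-smooth if all directional derivatives exist, each $Df(u):V\to W$, $u\in U$, is linear and continuous, and $U\ni u\mapsto Df(u)\in L_c(V,W)$ is $\beta$-continuous. *)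

theory Defs
  imports "HOL-Analysis.Analysis"
begin

text \<open>Topological vector spaces and Frechet spaces are real.  The constant
  \<open>bounded\<close> of the library refers to a metric; for an invariant metric it is not the notion
  of boundedness of a topological vector space, which is \<open>tvs_bounded\<close> below.\<close>

class topological_real_vector = real_vector + topological_ab_group_add +
  assumes tendsto_scaleR_Pair:
    "LIM x (nhds c \<times>\<^sub>F nhds a). fst x *\<^sub>R snd x :> nhds (c *\<^sub>R a)"

text \<open>A locally convex space whose topology is given by a complete translation-invariant metric.
  Everything below depends on the topology only, not on the choice of the metric.  Convexity is
  written out because a class specification cannot refer to \<open>convex\<close>, which is not a
  class operation.\<close>

class frechet_space = topological_real_vector + complete_space +
  assumes dist_translation: "dist (x + z) (y + z) = dist x y"
    and locally_convex_unfolded: "open S \<Longrightarrow> 0 \<in> S \<Longrightarrow>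
      \<exists>C. open C \<and> 0 \<in> C \<and> C \<subseteq> S \<and>
        (\<forall>x\<in>C. \<forall>y\<in>C. \<forall>s\<ge>0. \<forall>t\<ge>0. s + t = 1 \<longrightarrow> s *\<^sub>R x + t *\<^sub>R y \<in> C)"

lemma locally_convex:
  fixes S :: "'a::frechet_space set"
  assumes "open S" "0 \<in> S"
  shows "\<exists>C. open C \<and> convex C \<and> 0 \<in> C \<and> C \<subseteq> S"
  using locally_convex_unfolded[OF assms] unfolding convex_def by blast

instance real_normed_vector \<subseteq> topological_real_vector
proof
  fix c :: real and a :: 'a
  show "LIM x (nhds c \<times>\<^sub>F nhds a). fst x *\<^sub>R snd x :> nhds (c *\<^sub>R a)"
    by (intro tendsto_scaleR filterlim_fst filterlim_snd)
qed

instance banach \<subseteq> frechet_space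
proof
  fix x y z :: 'a and S :: "'a set"
  show "dist (x + z) (y + z) = dist x y" by (simp add: dist_norm)
  assume "open S" "0 \<in> S"
  then obtain e where "e > 0" "ball 0 e \<subseteq> S" by (meson openE)
  then show "\<exists>C. open C \<and> 0 \<in> C \<and> C \<subseteq> S \<and>
      (\<forall>x\<in>C. \<forall>y\<in>C. \<forall>s\<ge>0. \<forall>t\<ge>0. s + t = 1 \<longrightarrow> s *\<^sub>R x + t *\<^sub>R y \<in> C)"
    using convex_ball[of 0 e, unfolded convex_def] by (intro exI[of _ "ball 0 e"]) auto
qed

definition tvs_bounded :: "'a::topological_real_vector set \<Rightarrow> bool" where
  "tvs_bounded B \<longleftrightarrow>
     (\<forall>N. open N \<and> 0 \<in> N \<longrightarrow> (\<exists>r>0. \<forall>s>r. B \<subseteq> (\<lambda>x. s *\<^sub>R x) ` N))"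

definition L_c :: "('a::topological_real_vector \<Rightarrow> 'b::topological_real_vector) set" where
  "L_c = {A. linear A \<and> continuous_on UNIV A}"

text \<open>The translation-invariant topology on \<open>L_c\<close> whose basic neighbourhoods of \<open>0\<close> are the sets
  of those \<open>A\<close> with \<open>A ` B \<subseteq> N\<close>, where \<open>B\<close> is bounded and \<open>N\<close> is a neighbourhood of \<open>0\<close>.\<close>

definition beta :: "('a::topological_real_vector \<Rightarrow> 'b::topological_real_vector) topology" where
  "beta = topology (\<lambda>G. G \<subseteq> L_c \<and>
     (\<forall>A\<in>G. \<exists>B N. tvs_bounded B \<and> open N \<and> 0 \<in> N \<and>
        {A' \<in> L_c. (\<lambda>x. A' x - A x) ` B \<subseteq> N} \<subseteq> G))"

definition dir_quotient ::
    "('a::real_vector \<Rightarrow> 'b::real_vector) \<Rightarrow> 'a \<Rightarrow> 'a \<Rightarrow> real \<Rightarrow> 'b" where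
  "dir_quotient f u v t = (1 / t) *\<^sub>R (f (u + t *\<^sub>R v) - f u)"

definition has_dir_derivs ::
    "('a::real_vector \<Rightarrow> 'b::{topological_real_vector, t2_space}) \<Rightarrow> 'a set \<Rightarrow> bool" where
  "has_dir_derivs f U \<longleftrightarrow> (\<forall>u\<in>U. \<forall>v. \<exists>l. (dir_quotient f u v \<longlongrightarrow> l) (at 0))"

text \<open>Maps on an open set \<open>U\<close> are represented by total functions.  For \<open>u \<in> U\<close> the limit, and
  hence the derivative, depends only on the values of \<open>f\<close> on \<open>U\<close>.\<close>

definition dir_deriv ::
    "('a::real_vector \<Rightarrow> 'b::{topological_real_vector, t2_space}) \<Rightarrow> 'a \<Rightarrow> 'a \<Rightarrow> 'b" where
  "dir_deriv f u v = Lim (at 0) (dir_quotient f u v)"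

definition beta_continuous_on ::
    "'c::topological_space set \<Rightarrow>
     ('c \<Rightarrow> 'a::topological_real_vector \<Rightarrow> 'b::topological_real_vector) \<Rightarrow> bool" where
  "beta_continuous_on U g \<longleftrightarrow> continuous_map (top_of_set U) beta g"

definition C1_MB ::
    "'a::topological_real_vector set \<Rightarrow>
     ('a \<Rightarrow> 'b::{topological_real_vector, t2_space}) \<Rightarrow> bool" where
  "C1_MB U f \<longleftrightarrow> continuous_on U f \<and> has_dir_derivs f U \<and>
     continuous_on (U \<times> UNIV) (\<lambda>(u, v). dir_deriv f u v)"

definition C1_F ::
    "'a::topological_real_vector set \<Rightarrow>
     ('a \<Rightarrow> 'b::{topological_real_vector, t2_space}) \<Rightarrow> bool" where
  "C1_F U f \<longleftrightarrow> continuous_on U f \<and> has_dir_derivs f U \<and>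
     (\<forall>u\<in>U. linear (dir_deriv f u) \<and> continuous_on UNIV (dir_deriv f u)) \<and>
     beta_continuous_on U (dir_deriv f)"

lemma openin_beta:
  "openin beta G \<longleftrightarrow> G \<subseteq> L_c \<and>
     (\<forall>A\<in>G. \<exists>B N. tvs_bounded B \<and> open N \<and> 0 \<in> N \<and>
        {A' \<in> L_c. (\<lambda>x. A' x - A x) ` B \<subseteq> N} \<subseteq> G)"
proof -
  have bounded_Un: "tvs_bounded (B \<union> B')" if "tvs_bounded B" "tvs_bounded B'" for B B' :: "'a set"
    unfolding tvs_bounded_def
  proof (intro allI impI)
    fix N :: "'a set" assume N: "open N \<and> 0 \<in> N"
    have "\<exists>r>0. \<forall>s>r. B \<subseteq> (\<lambda>x. s *\<^sub>R x) ` N" "\<exists>r>0. \<forall>s>r. B' \<subseteq> (\<lambda>x. s *\<^sub>R x) ` N"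
      using that N by (simp_all add: tvs_bounded_def)
    then obtain r r' where "r > 0" "\<forall>s>r. B \<subseteq> (\<lambda>x. s *\<^sub>R x) ` N"
      "\<forall>s>r'. B' \<subseteq> (\<lambda>x. s *\<^sub>R x) ` N"
      by blast
    then show "\<exists>r>0. \<forall>s>r. B \<union> B' \<subseteq> (\<lambda>x. s *\<^sub>R x) ` N"
      by (intro exI[of _ "max r r'"]) auto
  qed
  define L where "L = (\<lambda>G :: ('a \<Rightarrow> 'b) set. G \<subseteq> L_c \<and>
     (\<forall>A\<in>G. \<exists>B N. tvs_bounded B \<and> open N \<and> 0 \<in> N \<and>
        {A' \<in> L_c. (\<lambda>x. A' x - A x) ` B \<subseteq> N} \<subseteq> G))"
  have "istopology L"
    unfolding istopology_def
  proof (intro conjI allI impI)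
    fix S T assume S: "L S" and T: "L T"
    show "L (S \<inter> T)"
      unfolding L_def
    proof (intro conjI ballI)
      show "S \<inter> T \<subseteq> L_c" using S by (auto simp: L_def)
      fix A assume A: "A \<in> S \<inter> T"
      obtain B N where 1: "tvs_bounded B" "open N" "0 \<in> N"
        "{A' \<in> L_c. (\<lambda>x. A' x - A x) ` B \<subseteq> N} \<subseteq> S"
        using S A unfolding L_def by blast
      obtain B' N' where 2: "tvs_bounded B'" "open N'" "0 \<in> N'"
        "{A' \<in> L_c. (\<lambda>x. A' x - A x) ` B' \<subseteq> N'} \<subseteq> T"
        using T A unfolding L_def by blast
      show "\<exists>B N. tvs_bounded B \<and> open N \<and> 0 \<in> N \<and>
          {A' \<in> L_c. (\<lambda>x. A' x - A x) ` B \<subseteq> N} \<subseteq> S \<inter> T"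
      proof (intro exI conjI)
        show "tvs_bounded (B \<union> B')" using bounded_Un 1(1) 2(1) .
        show "open (N \<inter> N')" "0 \<in> N \<inter> N'" using 1 2 by auto
        show "{A' \<in> L_c. (\<lambda>x. A' x - A x) ` (B \<union> B') \<subseteq> N \<inter> N'} \<subseteq> S \<inter> T"
          using 1(4) 2(4) by blast
      qed
    qed
  next
    fix K assume K: "\<forall>G\<in>K. L G"
    show "L (\<Union>K)"
      unfolding L_def
    proof (intro conjI ballI)
      show "\<Union>K \<subseteq> L_c" using K by (auto simp: L_def)
      fix A assume "A \<in> \<Union>K"
      then obtain G where G: "G \<in> K" "A \<in> G" by blast
      obtain B N where "tvs_bounded B" "open N" "0 \<in> N"
        "{A' \<in> L_c. (\<lambda>x. A' x - A x) ` B \<subseteq> N} \<subseteq> G"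
      proof -
        have "L G" using K G(1) by simp
        then show ?thesis using G(2) that unfolding L_def by fast
      qed
      moreover have "G \<subseteq> \<Union>K" using G(1) by blast
      ultimately show "\<exists>B N. tvs_bounded B \<and> open N \<and> 0 \<in> N \<and>
          {A' \<in> L_c. (\<lambda>x. A' x - A x) ` B \<subseteq> N} \<subseteq> \<Union>K"
        by (intro exI[of _ B] exI[of _ N]) simp
    qed
  qed
  then show ?thesis
    unfolding beta_def L_def[symmetric] by (simp add: topology_inverse' L_def)
qed

lemma topspace_beta: "topspace beta = L_c"
proof -
  have "tvs_bounded {}" "open UNIV" by (auto simp: tvs_bounded_def intro: exI[of _ 1])
  then have "openin beta L_c" unfolding openin_beta by blast
  then show ?thesis
    by (meson openin_beta openin_subset openin_topspace subset_antisym)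
qed

text \<open>The remaining lemmas show that for a \<open>C1_MB\<close> map into a Frechet space each derivative
  belongs to \<open>L_c\<close>, so that \<open>dir_deriv f\<close> is a map into the carrier of \<open>beta\<close>.  The membership
  in \<open>L_c\<close> that is part of \<open>beta_continuous_on\<close> therefore is no extra condition on such a map.\<close>

lemma tendsto_scaleR_tvs:
  fixes g :: "'c \<Rightarrow> 'b::topological_real_vector"
  assumes "(h \<longlongrightarrow> c) F" "(g \<longlongrightarrow> a) F"
  shows "((\<lambda>x. h x *\<^sub>R g x) \<longlongrightarrow> c *\<^sub>R a) F"
  using filterlim_compose[OF tendsto_scaleR_Pair, of "\<lambda>x. (h x, g x)" c a F] assms
  by (simp add: nhds_prod[symmetric] tendsto_Pair)

lemma dir_deriv_tendsto:
  assumes "has_dir_derivs f U" "u \<in> U"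
  shows "(dir_quotient f u v \<longlongrightarrow> dir_deriv f u v) (at 0)"
  using assms unfolding has_dir_derivs_def dir_deriv_def
  by (metis tendsto_Lim trivial_limit_at)

lemma difference_quotient_mem_convex:
  fixes h :: "real \<Rightarrow> 'b::topological_real_vector"
  assumes "a < b" and K: "open K" "convex K"
    and lim: "\<And>s. a \<le> s \<Longrightarrow> s \<le> b \<Longrightarrow> \<exists>l\<in>K. (dir_quotient h s 1 \<longlongrightarrow> l) (at 0)"
  shows "(1 / (b - a)) *\<^sub>R (h b - h a) \<in> K"
proof -
  define q where "q = (\<lambda>x y. (1 / (y - x)) *\<^sub>R (h y - h x))"
  have q_trans: "q x z \<in> K" if "q x y \<in> K" "q y z \<in> K" "x < y" "y < z" for x y z
  proof -
    have "((y - x) / (z - x)) *\<^sub>R q x y + ((z - y) / (z - x)) *\<^sub>R q y z \<in> K"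
    proof (rule convexD[OF K(2) that(1,2)])
      have "(y - x) / (z - x) + (z - y) / (z - x) = (z - x) / (z - x)"
        by (simp add: add_divide_distrib[symmetric])
      then show "(y - x) / (z - x) + (z - y) / (z - x) = 1" using that by simp
    qed (use that in auto)
    moreover have "((y - x) / (z - x)) *\<^sub>R q x y + ((z - y) / (z - x)) *\<^sub>R q y z = q x z"
      using that by (simp add: q_def scaleR_right_distrib[symmetric])
    ultimately show ?thesis by simp
  qed
  have q_sym: "q x y = q y x" for x y
  proof -
    have "q x y = (- (1 / (y - x))) *\<^sub>R (- (h y - h x))"
      by (simp only: q_def scaleR_minus_left scaleR_minus_right minus_minus)
    also have "- (1 / (y - x)) = 1 / (x - y)" by (metis minus_diff_eq divide_minus_right)
    finally show ?thesis by (simp add: q_def)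
  qed
  have "a < b \<longrightarrow> q a b \<in> K"
    using less_imp_le[OF \<open>a < b\<close>]
  proof (induction rule: Bolzano)
    case (trans x y z)
    then show ?case using q_trans[of x y z] by (cases "x = y"; cases "y = z") auto
  next
    case (local s)
    then obtain l where "l \<in> K" "(dir_quotient h s 1 \<longlongrightarrow> l) (at 0)" using lim by blast
    then have "\<forall>\<^sub>F t in at 0. dir_quotient h s 1 t \<in> K"
      using K(1) by (simp add: topological_tendstoD)
    then obtain d where d: "d > 0" "\<And>t. t \<noteq> 0 \<Longrightarrow> \<bar>t\<bar> < d \<Longrightarrow> dir_quotient h s 1 t \<in> K"
      by (auto simp: eventually_at dist_real_def)
    have near: "q s y \<in> K" if "y \<noteq> s" "\<bar>y - s\<bar> < d" for y
      using d(2)[of "y - s"] that by (simp add: dir_quotient_def q_def)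
    have "q x y \<in> K" if "x \<le> s" "s \<le> y" "y - x < d" "x < y" for x y
    proof (cases "x = s \<or> y = s")
      case True
      then show ?thesis using near[of x] near[of y] q_sym[of x s] that by auto
    next
      case False
      then show ?thesis using near[of x] near[of y] q_sym[of x s] q_trans[of x s y] that by auto
    qed
    then show ?case using d(1) by blast
  qed
  then show ?thesis using \<open>a < b\<close> by (simp add: q_def)
qed

lemma C1_MB_dir_deriv_in_L_c:
  fixes f :: "'a::topological_real_vector \<Rightarrow> 'b::frechet_space"
  assumes "open U" and f: "C1_MB U f" and u: "u \<in> U"
  shows "dir_deriv f u \<in> L_c"
proof -
  have has: "has_dir_derivs f U" and cont: "continuous_on (U \<times> UNIV) (\<lambda>(u, v). dir_deriv f u v)"
    using f by (auto simp: C1_MB_def)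
  note lim = dir_deriv_tendsto[OF has]
  have slice: "continuous_on S (\<lambda>x. dir_deriv f (p x) (r x))"
    if "continuous_on S p" "continuous_on S r" "p ` S \<subseteq> U" for S :: "'a set" and p r
    using continuous_on_compose2[OF cont continuous_on_Pair[OF that(1,2)]] that(3) by auto
  have scale: "dir_deriv f u (c *\<^sub>R v) = c *\<^sub>R dir_deriv f u v" for c v
  proof (cases "c = 0")
    case True
    have "(dir_quotient f u 0 \<longlongrightarrow> 0) (at 0)" by (simp add: dir_quotient_def[abs_def])
    then show ?thesis using True lim[OF u, of 0] tendsto_unique[OF trivial_limit_at] by auto
  next
    case False
    have "filterlim (\<lambda>t. c * t) (at 0) (at (0::real))"
      using False by (auto simp: filterlim_at eventually_at_filter intro!: tendsto_eq_intros)
    from filterlim_compose[OF lim[OF u] this]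
    have "((\<lambda>t. dir_quotient f u v (c * t)) \<longlongrightarrow> dir_deriv f u v) (at 0)" .
    from tendsto_scaleR_tvs[OF tendsto_const[of c] this]
    have "(dir_quotient f u (c *\<^sub>R v) \<longlongrightarrow> c *\<^sub>R dir_deriv f u v) (at 0)"
      using False by (simp add: dir_quotient_def[abs_def] mult.commute)
    then show ?thesis using lim[OF u, of "c *\<^sub>R v"] tendsto_unique[OF trivial_limit_at] by blast
  qed
  have add: "dir_deriv f u (v + w) = dir_deriv f u v + dir_deriv f u w" for v w
  proof -
    define g where "g = (\<lambda>t::real. (1 / t) *\<^sub>R (f (u + t *\<^sub>R v + t *\<^sub>R w) - f (u + t *\<^sub>R v)))"
    have "((\<lambda>t. dir_quotient f u (v + w) t - dir_quotient f u v t) \<longlongrightarrow>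
        dir_deriv f u (v + w) - dir_deriv f u v) (at 0)"
      by (intro tendsto_diff lim u)
    moreover have "(\<lambda>t. dir_quotient f u (v + w) t - dir_quotient f u v t) = g"
      by (simp add: fun_eq_iff dir_quotient_def g_def scaleR_right_distrib
          scaleR_right_diff_distrib add.assoc)
    ultimately have "(g \<longlongrightarrow> dir_deriv f u (v + w) - dir_deriv f u v) (at 0)" by simp
    then have 1: "(g \<longlongrightarrow> dir_deriv f u (v + w) - dir_deriv f u v) (at_right 0)"
      by (rule filterlim_at_split[THEN iffD1, THEN conjunct2])
    have 2: "(g \<longlongrightarrow> dir_deriv f u w) (at_right 0)"
    proof (rule topological_tendstoI)
      fix S :: "'b set" assume S: "open S" "dir_deriv f u w \<in> S"
      define c where "c = dir_deriv f u w"
      have "open ((\<lambda>x. c + x) -` S)"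
        by (rule open_vimage[OF S(1)]) (auto simp: continuous_on_def intro!: tendsto_intros)
      moreover have "0 \<in> (\<lambda>x. c + x) -` S" using S(2) by (simp add: c_def)
      ultimately obtain N where N: "open N" "convex N" "0 \<in> N" "N \<subseteq> (\<lambda>x. c + x) -` S"
        using locally_convex by blast
      define K where "K = (\<lambda>x. x - c) -` N"
      have K: "open K" "convex K" "c \<in> K" "K \<subseteq> S"
      proof -
        show "open K" unfolding K_def
          by (rule open_vimage[OF N(1)]) (auto simp: continuous_on_def intro!: tendsto_intros)
        have "K = (\<lambda>x. c + x) ` N" by (force simp: K_def image_iff)
        then show "convex K" using convex_translation[OF N(2), of c] by simp
        show "c \<in> K" using N(3) by (simp add: K_def)
        show "K \<subseteq> S" using N(4) by (force simp: K_def)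
      qed
      have "continuous_on U (\<lambda>x. dir_deriv f x w)" by (intro slice continuous_intros) auto
      then have "open (U \<inter> (\<lambda>x. dir_deriv f x w) -` K)"
        using continuous_on_open_vimage[OF \<open>open U\<close>] K(1) by (metis Int_commute)
      moreover have "((\<lambda>p. u + fst p *\<^sub>R v + snd p *\<^sub>R w) \<longlongrightarrow> u + 0 *\<^sub>R v + 0 *\<^sub>R w)
          (nhds (0::real) \<times>\<^sub>F nhds (0::real))"
        by (intro tendsto_add tendsto_scaleR_tvs tendsto_const filterlim_fst filterlim_snd)
      ultimately have "\<forall>\<^sub>F p in nhds 0 \<times>\<^sub>F nhds 0.
          u + fst p *\<^sub>R v + snd p *\<^sub>R w \<in> U \<inter> (\<lambda>x. dir_deriv f x w) -` K"
        using u K(3) by (intro topological_tendstoD) (auto simp: c_def)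
      then obtain P Q where PQ: "eventually P (nhds (0::real))" "eventually Q (nhds (0::real))"
        "\<And>t s. P t \<Longrightarrow> Q s \<Longrightarrow> u + t *\<^sub>R v + s *\<^sub>R w \<in> U \<inter> (\<lambda>x. dir_deriv f x w) -` K"
        unfolding eventually_prod_filter by auto
      obtain d where d: "d > 0" "\<And>t. \<bar>t\<bar> < d \<Longrightarrow> P t \<and> Q t"
        using eventually_conj[OF PQ(1,2)] by (auto simp: eventually_nhds_metric dist_real_def)
      have "g t \<in> S" if t: "0 < t" "t < d" for t
      proof -
        define h where "h = (\<lambda>s. f (u + t *\<^sub>R v + s *\<^sub>R w))"
        have "(1 / (t - 0)) *\<^sub>R (h t - h 0) \<in> K"
        proof (rule difference_quotient_mem_convex[OF t(1) K(1,2)])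
          fix s assume s: "0 \<le> s" "s \<le> t"
          define x where "x = u + t *\<^sub>R v + s *\<^sub>R w"
          have x: "x \<in> U" "dir_deriv f x w \<in> K"
            using PQ(3)[of t s] d(2)[of t] d(2)[of s] s t by (auto simp: x_def)
          have "dir_quotient h s 1 = dir_quotient f x w"
            by (simp add: fun_eq_iff dir_quotient_def h_def x_def scaleR_left_distrib add.assoc)
          then show "\<exists>l\<in>K. (dir_quotient h s 1 \<longlongrightarrow> l) (at 0)"
            using lim[OF x(1), of w] x(2) by auto
        qed
        then show ?thesis using K(4) by (auto simp: h_def g_def)
      qed
      then show "\<forall>\<^sub>F t in at_right 0. g t \<in> S"
        using d(1) by (auto simp: eventually_at_right_field)
    qed
    have "dir_deriv f u (v + w) - dir_deriv f u v = dir_deriv f u w"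
      by (rule tendsto_unique[OF _ 1 2]) simp
    then show ?thesis by (simp add: algebra_simps)
  qed
  have "continuous_on UNIV (dir_deriv f u)"
    using slice[of UNIV "\<lambda>_. u" "\<lambda>v. v"] u by auto
  then show ?thesis
    unfolding L_c_def using linearI[of "dir_deriv f u", OF add scale] by simp
qed

end

theory Submission
  imports Defs
begin

text \<open>On metrizable spaces joint continuity of \<open>(u, v) \<mapsto> Df(u)v\<close> can be tested on sequences.  A
  convergent sequence together with its limit is compact, hence bounded, so \<open>\<beta>\<close>-continuity makes
  \<open>(Df(u\<^sub>n) - Df(u)) v\<^sub>n\<close> tend to \<open>0\<close>, while \<open>Df(u) v\<^sub>n\<close> tends to \<open>Df(u)v\<close>.  In the converse
  direction the only issue is linearity of \<open>Df(u)\<close>, which is \<open>C1_MB_dir_deriv_in_L_c\<close>.\<close>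

text \<open>Scalar multiplication is jointly continuous at (0, x), so every x has a neighbourhood
  \<open>W x\<close> which all scalars below some \<open>d x\<close> in absolute value send into
  \<open>N\<close>. Finitely many of these cover \<open>K\<close>, and a large \<open>s\<close>
  makes 1/s smaller than each of the finitely many \<open>d x\<close>.\<close>

lemma compact_imp_tvs_bounded:
  fixes K :: "'a::topological_real_vector set"
  assumes "compact K"
  shows "tvs_bounded K"
  unfolding tvs_bounded_def
proof (intro allI impI)
  fix N :: "'a set" assume N: "open N \<and> 0 \<in> N"
  have "\<exists>d W. d > 0 \<and> open W \<and> x \<in> W \<and> (\<forall>t. \<forall>w\<in>W. \<bar>t\<bar> < d \<longrightarrow> t *\<^sub>R w \<in> N)" for x
  proof -
    have "\<forall>\<^sub>F p in nhds 0 \<times>\<^sub>F nhds x. fst p *\<^sub>R snd p \<in> N"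
      using N by (intro topological_tendstoD[OF tendsto_scaleR_Pair]) auto
    then obtain P Q where PQ: "eventually P (nhds (0::real))" "eventually Q (nhds x)"
      "\<And>t w. P t \<Longrightarrow> Q w \<Longrightarrow> t *\<^sub>R w \<in> N"
      unfolding eventually_prod_filter by auto
    then show ?thesis
      unfolding eventually_nhds_metric[of P] eventually_nhds[of Q] dist_real_def
      by (metis diff_zero)
  qed
  then obtain d W where d: "\<And>x. d x > 0" and W: "\<And>x. open (W x)" "\<And>x. x \<in> W x"
    and small: "\<And>x t w. w \<in> W x \<Longrightarrow> \<bar>t\<bar> < d x \<Longrightarrow> t *\<^sub>R w \<in> N"
    by metis
  obtain X where X: "X \<subseteq> K" "finite X" "K \<subseteq> (\<Union>x\<in>X. W x)"
    using compactE_image[OF assms, of K W] W by blast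
  \<comment> \<open>Inserting 1 makes \<open>r\<close> positive and keeps the maximum meaningful if
    \<open>X\<close> is empty.\<close>
  define r where "r = Max (insert 1 ((\<lambda>x. 1 / d x) ` X))"
  have r: "r \<ge> 1" "\<And>x. x \<in> X \<Longrightarrow> 1 / d x \<le> r" using X(2) by (simp_all add: r_def)
  have "w \<in> (\<lambda>x. s *\<^sub>R x) ` N" if "s > r" "w \<in> K" for s w
  proof -
    obtain x where x: "x \<in> X" "w \<in> W x" using X(3) \<open>w \<in> K\<close> by blast
    have "1 / d x < s" "s > 0" using r(1) r(2)[OF x(1)] \<open>s > r\<close> by linarith+
    then have "\<bar>1 / s\<bar> < d x" using d[of x] by (simp add: field_simps)
    then have "(1 / s) *\<^sub>R w \<in> N" using small x(2) by blast
    moreover have "w = s *\<^sub>R ((1 / s) *\<^sub>R w)" using \<open>s > 0\<close> by simp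
    ultimately show ?thesis by blast
  qed
  then show "\<exists>r>0. \<forall>s>r. K \<subseteq> (\<lambda>x. s *\<^sub>R x) ` N"
    using r(1) by (intro exI[of _ r]) auto
qed

text \<open>By definition \<open>beta\<close>-open sets contain basic neighbourhoods of their points; that basic
  neighbourhoods are in turn neighbourhoods requires splitting \<open>N\<close>.\<close>

lemma beta_basic_neighbourhood:
  fixes A :: "'a::topological_real_vector \<Rightarrow> 'b::topological_real_vector"
  assumes A: "A \<in> L_c" and B: "tvs_bounded B" and N: "open N" "0 \<in> N"
  obtains G where "openin beta G" "A \<in> G" "\<And>A'. A' \<in> G \<Longrightarrow> (\<lambda>x. A' x - A x) ` B \<subseteq> N"
proof
  \<comment> \<open>The margin \<open>M\<close> is the same for all \<open>x\<close> in
    \<open>B\<close>. Openness of \<open>N\<close> alone would give only a margin for each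
    \<open>x\<close>, which may shrink along \<open>B\<close>. Taking m = 0 shows that
    \<open>A' - A\<close> maps \<open>B\<close> into \<open>N\<close>.\<close>
  define G where "G = {A' \<in> L_c. \<exists>M. open M \<and> 0 \<in> M \<and> (\<forall>x\<in>B. \<forall>m\<in>M. A' x - A x + m \<in> N)}"
  show "openin beta G"
    unfolding openin_beta
  proof (intro conjI ballI)
    fix A' assume "A' \<in> G"
    then obtain M where M: "open M" "0 \<in> M" "\<And>x m. x \<in> B \<Longrightarrow> m \<in> M \<Longrightarrow> A' x - A x + m \<in> N"
      by (auto simp: G_def)
    \<comment> \<open>Choose \<open>M'\<close> with M' + M' inside \<open>M\<close>: one summand
      absorbs \<open>A'' - A'\<close> on \<open>B\<close>, the other remains as the margin of
      \<open>A''\<close>.\<close>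
    have "\<forall>\<^sub>F p in nhds (0::'b) \<times>\<^sub>F nhds 0. fst p + snd p \<in> M"
      using M(1,2) by (intro topological_tendstoD[OF tendsto_add_Pair]) auto
    then obtain P Q where "eventually P (nhds (0::'b))" "eventually Q (nhds (0::'b))"
      and PQ: "\<And>x y. P x \<Longrightarrow> Q y \<Longrightarrow> x + y \<in> M"
      unfolding eventually_prod_filter by auto
    then have "eventually (\<lambda>x. P x \<and> Q x) (nhds 0)" by (intro eventually_conj)
    then obtain M' where M': "open M'" "0 \<in> M'" "\<And>x y. x \<in> M' \<Longrightarrow> y \<in> M' \<Longrightarrow> x + y \<in> M"
      unfolding eventually_nhds using PQ by blast
    have "A'' x - A x + m \<in> N"
      if "(\<lambda>x. A'' x - A' x) ` B \<subseteq> M'" "x \<in> B" "m \<in> M'" for A'' x m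
    proof -
      have "A' x - A x + ((A'' x - A' x) + m) \<in> N" using that by (intro M M') auto
      then show ?thesis by (simp add: algebra_simps)
    qed
    then have "{A'' \<in> L_c. (\<lambda>x. A'' x - A' x) ` B \<subseteq> M'} \<subseteq> G"
      using M'(1,2) unfolding G_def by blast
    then show "\<exists>B N. tvs_bounded B \<and> open N \<and> 0 \<in> N \<and>
        {A'' \<in> L_c. (\<lambda>x. A'' x - A' x) ` B \<subseteq> N} \<subseteq> G"
      using B M'(1,2) by blast
  qed (auto simp: G_def)
  \<comment> \<open>For \<open>A\<close> itself the margin is \<open>N\<close>, as the difference
    vanishes.\<close>
  show "A \<in> G" using A N by (auto simp: G_def)
  show "(\<lambda>x. A' x - A x) ` B \<subseteq> N" if "A' \<in> G" for A'
    using that by (force simp: G_def)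
qed

lemma beta_continuous_on_imp_jointly_continuous:
  fixes g :: "'c::metric_space \<Rightarrow> 'a::{topological_real_vector, metric_space}
    \<Rightarrow> 'b::topological_real_vector"
  assumes "beta_continuous_on U g"
  shows "continuous_on (U \<times> UNIV) (\<lambda>(u, v). g u v)"
  unfolding continuous_on_sequentially
proof (intro allI ballI impI, elim conjE)
  have g: "continuous_map (top_of_set U) beta g"
    using assms by (simp add: beta_continuous_on_def)
  fix p :: "nat \<Rightarrow> 'c \<times> 'a" and q
  assume q: "q \<in> U \<times> UNIV" and p: "\<forall>n. p n \<in> U \<times> UNIV" and lim: "p \<longlonglongrightarrow> q"
  obtain u v where uv: "q = (u, v)" by (cases q)
  define u' v' where "u' = fst \<circ> p" and "v' = snd \<circ> p"
  have u: "u \<in> U" "\<And>n. u' n \<in> U" "u' \<longlonglongrightarrow> u" and v: "v' \<longlonglongrightarrow> v"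
    using q p tendsto_fst[OF lim] tendsto_snd[OF lim]
    by (auto simp: uv u'_def v'_def mem_Times_iff o_def)
  \<comment> \<open>A continuous map into \<open>beta\<close> takes values in its carrier; this
    supplies the continuity of \<open>g u\<close>.\<close>
  have gu: "g u \<in> L_c"
    using continuous_map_image_subset_topspace[OF g] u(1) by (auto simp: topspace_beta)
  have "(\<lambda>n. g (u' n) (v' n) - g u (v' n)) \<longlonglongrightarrow> 0"
  proof (rule topological_tendstoI)
    fix N :: "'b set" assume N: "open N" "0 \<in> N"
    \<comment> \<open>One bounded set contains all the arguments \<open>v' n\<close>, so a single
      \<open>G\<close> serves every \<open>n\<close>.\<close>
    have "tvs_bounded (insert v (range v'))"
      using compactin_sequence_with_limit[of euclidean v' v "range v'"] v
      by (simp add: compact_imp_tvs_bounded)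
    from beta_basic_neighbourhood[OF gu this N]
    obtain G where G: "openin beta G" "g u \<in> G"
      "\<And>A. A \<in> G \<Longrightarrow> (\<lambda>x. A x - g u x) ` insert v (range v') \<subseteq> N"
      by blast
    have "openin (top_of_set U) {x \<in> U. g x \<in> G}"
      using openin_continuous_map_preimage[OF g G(1)] by simp
    then obtain T where T: "open T" "{x \<in> U. g x \<in> G} = U \<inter> T"
      unfolding openin_open by blast
    have "\<forall>\<^sub>F n in sequentially. u' n \<in> T"
      using topological_tendstoD[OF u(3) T(1)] T(2) u(1) G(2) by blast
    then show "\<forall>\<^sub>F n in sequentially. g (u' n) (v' n) - g u (v' n) \<in> N"
    proof eventually_elim
      case (elim n)
      then have "g (u' n) \<in> G" using T(2) u(2) by blast
      then show ?case using G(3) by blast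
    qed
  qed
  moreover have "(\<lambda>n. g u (v' n)) \<longlonglongrightarrow> g u v"
    using gu v by (auto simp: L_c_def intro: continuous_on_tendsto_compose)
  ultimately have "(\<lambda>n. g (u' n) (v' n) - g u (v' n) + g u (v' n)) \<longlonglongrightarrow> 0 + g u v"
    by (rule tendsto_add)
  then show "((\<lambda>(u, v). g u v) \<circ> p) \<longlonglongrightarrow> (case q of (u, v) \<Rightarrow> g u v)"
    by (simp add: uv u'_def v'_def o_def case_prod_unfold)
qed

theorem proposition3p2:
  fixes U :: "'v::frechet_space set" and f :: "'v \<Rightarrow> 'f::frechet_space"
  assumes "open U"
  shows "C1_F U f \<longleftrightarrow> C1_MB U f \<and> beta_continuous_on U (dir_deriv f)"
proof
  \<comment> \<open>The \<open>beta\<close>-continuity is part of \<open>C1_F\<close>, so only joint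
    continuity remains.\<close>
  assume "C1_F U f"
  then show "C1_MB U f \<and> beta_continuous_on U (dir_deriv f)"
    using beta_continuous_on_imp_jointly_continuous by (auto simp: C1_F_def C1_MB_def)
next
  assume f: "C1_MB U f \<and> beta_continuous_on U (dir_deriv f)"
  then have "dir_deriv f u \<in> L_c" if "u \<in> U" for u
    using C1_MB_dir_deriv_in_L_c[OF assms _ that] by blast
  then show "C1_F U f" using f by (simp add: C1_F_def C1_MB_def L_c_def)
qed

end
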